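(* Assume in addition to the standing assumptions that $\omega_x\le1$ and $\vec p_c<p_1=\mathbb P\{\omega_0=1\}<1$. Let $B$ be the Busemann function of the percolation cone, i.e. the stationary $L^1(\mathbb P)$ cocycle such that, for $\mathbb P$-a.e. $\omega$, $B(\omega,x,y)=\lim_{n\to\infty}(G_{x,v_n}(\omega)-G_{y,v_n}(\omega))$ for all $x,y\in\mathbb Z^2$ and every sequence $v_n\in\mathbb Z_+^2$ with $$|v_n|_1\to\infty\quad\text{and}\quad1-\beta_{p_1}\le\varliminf_{n\to\infty}\frac{v_n\cdot e_1}{|v_n|_1}\le\varlimsup_{n\to\infty}\frac{v_n\cdot e_1}{|v_n|_1}\le\beta_{p_1}.$$ Then, $\mathbb P$-almost surely, for all $x,y\in\mathbb Z^2$, $$B(\omega,x,y)=(y-x)\cdot(e_1+e_2)+\psi(T_y\omega)-\psi(T_x\omega),$$ where $$\psi(\omega)=\inf_{x_{0,\infty}:\,x_0=0}\ \sum_{k=0}^\infty(1-\omega_{x_k}),$$ the infimum being over all infinite up-right paths $x_{0,\infty}=(x_k)_{k\ge0}$ in $\mathbb Z^2$ that start at $x_0=0$.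
   Context: **Setting.** $\Omega=\mathbb R^{\mathbb Z^2}$ with Borel $\sigma$-algebra, $\omega=(\omega_x)_{x\in\mathbb Z^2}$, translations $(T_x\omega)_y=\omega_{x+y}$. $\mathbb P$ is a probability measure on $\Omega$ under which $\{\omega_x\}$ are i.i.d., $\mathbb E[|\omega_0|^p]<\infty$ for some $p>2$, $\mathrm{Var}(\omega_0)>0$, $\mathbb P(\omega_0\ge c)=1$ for some $c>-\infty$ (standing assumptions). $e_1=(1,0)$, $e_2=(0,1)$, $|x|_1=|x\cdot e_1|+|x\cdot e_2|$, $x\le y$ coordinatewise. Up-right paths have increments in $\{e_1,e_2\}$. For $x\le y$ in $\mathbb Z^2$, $G_{x,y}=\max\sum_{k=0}^{n-1}\omega_{x_k}$ over up-right paths $x=x_0,\dots,x_n=y$, $n=|y-x|_1$. A stationary $L^1(\mathbb P)$ cocycle is a measurable $B:\Omega\times\mathbb Z^2\times\mathbb Z^2\to\mathbb R$ with $\mathbb E|B(0,e_i)|<\infty$ and, a.s. for all $x,y,z$, $B(\omega,z+x,z+y)=B(T_z\omega,x,y)$ and $B(\omega,x,y)+B(\omega,y,z)=B(\omega,x,z)$. The limit defining $B$ is known to exist under the stated assumptions. **Oriented site percolation.** Let $\{\sigma_z\}_{z\in\mathbb Z^2}$ be i.i.d. $\{0,1\}$-valued with $P\{\sigma_0=1\}=p_1$. For $u\le v$, $u\to v$ means there is an up-right path $u=x_0,\dots,x_m=v$ with $\sigma_{x_i}=1$ for $i=1,\dots,m$; $\{u\to\infty\}$ is the existence of an infinite open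 up-right path from $u$. $\vec p_c\in(0,1)$ is the critical value: $P\{0\to\infty\}=0$ if $p_1<\vec p_c$ and $>0$ if $p_1>\vec p_c$. With $a_n=\max\{u\cdot e_1:u\in\mathbb Z_+^2,|u|_1=n,0\to u\}$, for $p_1\in(\vec p_c,1)$ the constant $\beta_{p_1}\in(1/2,1)$ is the a.s. limit of $a_n/n$ on the event $\{0\to\infty\}$. *)

theory Defs
  imports "HOL-Probability.Probability"
begin

type_synonym site = "int \<times> int"
type_synonym env = "site \<Rightarrow> real"

definition e1 :: site where "e1 = (1, 0)"

definition e2 :: site where "e2 = (0, 1)"

definition l1 :: "site \<Rightarrow> nat" where
  "l1 x = nat (\<bar>fst x\<bar> + \<bar>snd x\<bar>)"

definition translate :: "site \<Rightarrow> env \<Rightarrow> env" where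
  "translate x \<omega> = (\<lambda>y. \<omega> (x + y))"

(* Only the values at times 0, ..., l1 (y - x) matter; later values are unconstrained.
   The set is empty unless x \<le> y coordinatewise. *)
definition up_right_paths :: "site \<Rightarrow> site \<Rightarrow> (nat \<Rightarrow> site) set" where
  "up_right_paths x y =
     {\<gamma>. \<gamma> 0 = x \<and> \<gamma> (l1 (y - x)) = y \<and>
          (\<forall>k < l1 (y - x). \<gamma> (Suc k) - \<gamma> k \<in> {e1, e2})}"

definition infinite_up_right_paths :: "site \<Rightarrow> (nat \<Rightarrow> site) set" where
  "infinite_up_right_paths x = {\<gamma>. \<gamma> 0 = x \<and> (\<forall>k. \<gamma> (Suc k) - \<gamma> k \<in> {e1, e2})}"

(* The weight of the terminal point y is not collected.  The maximum is over a finite set of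
   values, nonempty when x \<le> y coordinatewise; otherwise the value is unspecified. *)
definition last_passage :: "env \<Rightarrow> site \<Rightarrow> site \<Rightarrow> real" where
  "last_passage \<omega> x y = Max ((\<lambda>\<gamma>. \<Sum>k < l1 (y - x). \<omega> (\<gamma> k)) ` up_right_paths x y)"

definition stationary_L1_cocycle :: "env measure \<Rightarrow> (env \<Rightarrow> site \<Rightarrow> site \<Rightarrow> real) \<Rightarrow> bool" where
  "stationary_L1_cocycle P B \<longleftrightarrow>
     (\<forall>x y. (\<lambda>\<omega>. B \<omega> x y) \<in> borel_measurable P) \<and>
     integrable P (\<lambda>\<omega>. B \<omega> 0 e1) \<and> integrable P (\<lambda>\<omega>. B \<omega> 0 e2) \<and>
     (AE \<omega> in P. \<forall>x y z. B \<omega> (z + x) (z + y) = B (translate z \<omega>) x y) \<and>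
     (AE \<omega> in P. \<forall>x y z. B \<omega> x y + B \<omega> y z = B \<omega> x z)"

definition open_connected :: "(site \<Rightarrow> bool) \<Rightarrow> site \<Rightarrow> site \<Rightarrow> bool" where
  "open_connected \<sigma> u v \<longleftrightarrow> (\<exists>\<gamma> \<in> up_right_paths u v. \<forall>k \<le> l1 (v - u). \<sigma> (\<gamma> k))"

definition percolates :: "(site \<Rightarrow> bool) \<Rightarrow> site \<Rightarrow> bool" where
  "percolates \<sigma> u \<longleftrightarrow> (\<exists>\<gamma> \<in> infinite_up_right_paths u. \<forall>k. \<sigma> (\<gamma> k))"

definition site_percolation :: "real \<Rightarrow> (site \<Rightarrow> bool) measure" where
  "site_percolation p = PiM UNIV (\<lambda>_. measure_pmf (bernoulli_pmf p))"

definition critical_probability :: real where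
  "critical_probability =
     Sup {p \<in> {0..1}. measure (site_percolation p)
                         {\<sigma> \<in> space (site_percolation p). percolates \<sigma> 0} = 0}"

(* Unspecified if no site of level n is reached from the origin, which cannot happen
   when the origin percolates. *)
definition right_edge :: "(site \<Rightarrow> bool) \<Rightarrow> nat \<Rightarrow> int" where
  "right_edge \<sigma> n =
     Max {fst u | u. 0 \<le> fst u \<and> 0 \<le> snd u \<and> l1 u = n \<and> open_connected \<sigma> 0 u}"

(* For p above the critical probability the event that the origin percolates has positive
   probability, so this property determines b. *)
definition edge_speed :: "real \<Rightarrow> real \<Rightarrow> bool" where
  "edge_speed p b \<longleftrightarrow>
     (AE \<sigma> in site_percolation p. percolates \<sigma> 0 \<longrightarrow>
        (\<lambda>n. real_of_int (right_edge \<sigma> n) / real n) \<longlonglongrightarrow> b)"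

definition cone_sequence :: "real \<Rightarrow> (nat \<Rightarrow> site) \<Rightarrow> bool" where
  "cone_sequence b v \<longleftrightarrow>
     (\<forall>n. 0 \<le> fst (v n) \<and> 0 \<le> snd (v n)) \<and>
     filterlim (\<lambda>n. l1 (v n)) at_top sequentially \<and>
     ereal (1 - b) \<le> liminf (\<lambda>n. ereal (real_of_int (fst (v n)) / real (l1 (v n)))) \<and>
     limsup (\<lambda>n. ereal (real_of_int (fst (v n)) / real (l1 (v n)))) \<le> ereal b"

(* The series has its intended value in [0, \<infinity>] when all weights are at most 1;
   no meaning is attached to other environments. *)
definition psi :: "env \<Rightarrow> ereal" where
  "psi \<omega> = (INF \<gamma> \<in> infinite_up_right_paths 0. \<Sum>k. ereal (1 - \<omega> (\<gamma> k)))"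

end

theory Submission
  imports Defs
begin

text \<open>
  Put \<open>\<tau> = 1 - \<omega> \<ge> 0\<close>.  Up to the deterministic term \<open>level y - level x\<close>, the Busemann function
  compares the minimal \<open>\<tau>\<close>-costs of paths from \<open>x\<close> and from \<open>y\<close> to a far point, while \<open>psi\<close> is the
  minimal \<open>\<tau>\<close>-cost of an infinite path.  So the claim says that the cost from \<open>x\<close> to suitable far
  points converges to \<open>psi (translate x \<omega>)\<close>.  The far points are taken along an infinite path
  \<open>\<gamma>\<close> of sites with \<open>\<tau> = 0\<close>, an open ray.  The edge speed puts open rays into the percolation
  cone, hence almost surely the limit defining \<open>B\<close> exists along all of them at once.

  Since moving along \<open>\<gamma>\<close> is free, the cost from \<open>x\<close> to the \<open>n\<close>-th site of \<open>\<gamma>\<close> decreases in \<open>n\<close>;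
  write \<open>ray_cost \<omega> \<gamma> x\<close> for its limit.  Then \<open>B x y\<close> is
  \<open>level y - level x + ray_cost \<omega> \<gamma> y - ray_cost \<omega> \<gamma> x\<close> (lemma \<open>busemann_eq_ray_cost\<close>).  Following
  a finite path by the rest of \<open>\<gamma>\<close> shows that \<open>psi\<close> is at most \<open>ray_cost\<close>.

  The reverse inequality rests on the fact that \<open>B\<close> is the same for all open rays.  Let \<open>\<gamma>\<close> start
  at \<open>v\<close> and \<open>\<gamma>'\<close> at \<open>u\<close>.  Computing \<open>B v u\<close> along both rays gives
  \<open>ray_cost \<omega> \<gamma> u = - ray_cost \<omega> \<gamma>' v\<close>.  Both costs are nonnegative, so both vanish
  (lemma \<open>ray_cost_percolating\<close>): from every percolating site one reaches far points of every open
  ray at arbitrarily small cost.  Given any infinite path \<open>\<xi>\<close> from \<open>x\<close>, take a percolating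
  \<open>u\<close> on the left of \<open>\<xi>\<close> and a percolating \<open>v\<close> on the right of it, and an open ray \<open>\<gamma>\<close> from \<open>v\<close>.
  A cheap path from \<open>u\<close> to a far site of \<open>\<gamma>\<close> must cross \<open>\<xi>\<close>, unless \<open>\<gamma>\<close> itself has done so.
  In both cases one can follow \<open>\<xi>\<close> up to the crossing and reach \<open>\<gamma>\<close> from there at small extra cost,
  so \<open>ray_cost \<omega> \<gamma> x\<close> is at most the cost of \<open>\<xi>\<close> (lemma \<open>ray_cost_below_le_path_cost\<close>).

  The probabilistic input is light.  Percolating sites exist on both sides of every site by
  Kolmogorov's zero-one law, applied to the rows of the lattice
  (lemma \<open>AE_percolates_on_antidiagonal\<close>).  Open rays leave every horizontal or vertical strip because
  \<open>p1 < 1\<close> excludes open half-lines.  All almost sure statements are proved for, or assumed of, the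
  Bernoulli percolation measure at the origin; they are carried over to \<open>P\<close> and to all sites and both
  orientations through the maps \<open>\<omega> \<mapsto> (\<lambda>z. \<omega> (f z) = 1)\<close> with injective \<open>f\<close>.
\<close>

section \<open>Up-right paths and passage costs\<close>

definition level :: "site \<Rightarrow> int" where
  "level x = fst x + snd x"

definition up_right :: "(nat \<Rightarrow> site) \<Rightarrow> nat \<Rightarrow> bool" where
  "up_right \<eta> m \<longleftrightarrow> (\<forall>k<m. \<eta> (Suc k) - \<eta> k \<in> {e1, e2})"

definition splice_path :: "(nat \<Rightarrow> site) \<Rightarrow> nat \<Rightarrow> (nat \<Rightarrow> site) \<Rightarrow> nat \<Rightarrow> site" where
  "splice_path \<eta> m \<gamma> = (\<lambda>k. if k < m then \<eta> k else \<gamma> (k - m))"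

text \<open>
  All paths from \<open>x\<close> to \<open>y\<close> have \<open>l1 (y - x)\<close> steps, so for \<open>x \<le> y\<close> this is the minimum of the
  total of \<open>1 - \<omega>\<close> over them.  Unlike \<open>last_passage\<close> it is comparable with \<open>psi\<close>.
\<close>
definition passage_cost :: "env \<Rightarrow> site \<Rightarrow> site \<Rightarrow> real" where
  "passage_cost \<omega> x y = real (l1 (y - x)) - last_passage \<omega> x y"

lemma step_cases:
  assumes "z - y \<in> {e1, e2}"
  shows "(fst z = fst y + 1 \<and> snd z = snd y) \<or> (fst z = fst y \<and> snd z = snd y + 1)"
  using assms by (cases z, cases y) (auto simp: e1_def e2_def)

lemma up_right_mono:
  assumes "up_right \<eta> m" "i \<le> j" "j \<le> m"
  shows "\<eta> i \<le> \<eta> j" and "level (\<eta> j) = level (\<eta> i) + int (j - i)"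
proof -
  have "j \<le> m \<longrightarrow> \<eta> i \<le> \<eta> j \<and> level (\<eta> j) = level (\<eta> i) + int (j - i)"
    using assms(2)
  proof (induction j rule: dec_induct)
    case (step n)
    show ?case
    proof
      assume "Suc n \<le> m"
      then have "\<eta> (Suc n) - \<eta> n \<in> {e1, e2}"
        using assms(1) by (auto simp: up_right_def)
      from step_cases[OF this] step \<open>Suc n \<le> m\<close>
      show "\<eta> i \<le> \<eta> (Suc n) \<and> level (\<eta> (Suc n)) = level (\<eta> i) + int (Suc n - i)"
        by (auto simp: less_eq_prod_def level_def)
    qed
  qed auto
  then show "\<eta> i \<le> \<eta> j" "level (\<eta> j) = level (\<eta> i) + int (j - i)"
    using assms(3) by auto
qed

lemma l1_eq_level: "x \<le> y \<Longrightarrow> int (l1 (y - x)) = level y - level x"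
  by (auto simp: l1_def level_def less_eq_prod_def)

lemma up_right_l1:
  assumes "up_right \<eta> m" "i \<le> j" "j \<le> m"
  shows "l1 (\<eta> j - \<eta> i) = j - i"
  using l1_eq_level[OF up_right_mono(1)[OF assms]] up_right_mono(2)[OF assms] by simp

lemma up_right_paths_alt:
  "\<gamma> \<in> up_right_paths x y \<longleftrightarrow> \<gamma> 0 = x \<and> \<gamma> (l1 (y - x)) = y \<and> up_right \<gamma> (l1 (y - x))"
  by (auto simp: up_right_paths_def up_right_def)

lemma infinite_up_right_paths_alt:
  "\<gamma> \<in> infinite_up_right_paths x \<longleftrightarrow> \<gamma> 0 = x \<and> (\<forall>m. up_right \<gamma> m)"
  by (auto simp: infinite_up_right_paths_def up_right_def)

text \<open>
  The path set itself is infinite, because the times after arrival are unconstrained.  The collected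
  weight depends only on the restriction to earlier times, and these restrictions map into a finite
  box.  Without finiteness the maximum in \<open>last_passage\<close> would carry no information.
\<close>
lemma finite_path_values:
  "finite ((\<lambda>\<gamma>. \<Sum>k < l1 (y - x). \<omega> (\<gamma> k)) ` up_right_paths x y)"
proof -
  let ?n = "l1 (y - x)"
  let ?box = "{fst x..fst y} \<times> {snd x..snd y}"
  have "(\<lambda>\<gamma>. \<Sum>k < ?n. \<omega> (\<gamma> k)) ` up_right_paths x y
      \<subseteq> (\<lambda>\<gamma>. \<Sum>k < ?n. \<omega> (\<gamma> k)) ` (PiE {..<?n} (\<lambda>_. ?box))"
  proof
    fix s assume "s \<in> (\<lambda>\<gamma>. \<Sum>k < ?n. \<omega> (\<gamma> k)) ` up_right_paths x y"
    then obtain \<gamma> where g: "\<gamma> \<in> up_right_paths x y" and s: "s = (\<Sum>k < ?n. \<omega> (\<gamma> k))" by auto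
    have "\<gamma> k \<in> ?box" if "k < ?n" for k
    proof -
      have "x \<le> \<gamma> k" "\<gamma> k \<le> y"
        using up_right_mono(1)[of \<gamma> ?n 0 k] up_right_mono(1)[of \<gamma> ?n k ?n] g that
        by (auto simp: up_right_paths_alt)
      then show ?thesis by (cases "\<gamma> k") (auto simp: less_eq_prod_def)
    qed
    then have "restrict \<gamma> {..<?n} \<in> PiE {..<?n} (\<lambda>_. ?box)" by auto
    moreover have "s = (\<Sum>k < ?n. \<omega> (restrict \<gamma> {..<?n} k))" using s by simp
    ultimately show "s \<in> (\<lambda>\<gamma>. \<Sum>k < ?n. \<omega> (\<gamma> k)) ` (PiE {..<?n} (\<lambda>_. ?box))" by blast
  qed
  then show ?thesis
    by (rule finite_subset) (intro finite_imageI finite_PiE, auto)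
qed

text \<open>
  Go right until the column of \<open>y\<close> is reached, then up.
\<close>
lemma ex_up_right_path:
  assumes "x \<le> y"
  shows "up_right_paths x y \<noteq> {}"
proof -
  define a where "a = nat (fst y - fst x)"
  define b where "b = nat (snd y - snd x)"
  define \<gamma> where "\<gamma> k = (if k < a then (fst x + int k, snd x) else (fst y, snd x + int (k - a)))" for k
  have *: "l1 (y - x) = a + b" "fst y = fst x + int a" "snd y = snd x + int b"
    using assms by (auto simp: l1_def a_def b_def less_eq_prod_def)
  have "\<gamma> (Suc k) - \<gamma> k \<in> {e1, e2}" for k
    by (cases "Suc k < a"; cases "k < a") (auto simp: \<gamma>_def e1_def e2_def *(2) Suc_diff_le of_nat_diff)
  moreover have "\<gamma> 0 = x" "\<gamma> (a + b) = y"
    by (auto simp: \<gamma>_def *(2,3) prod_eq_iff)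
  ultimately have "\<gamma> \<in> up_right_paths x y"
    by (auto simp: up_right_paths_alt * up_right_def)
  then show ?thesis by blast
qed

lemma passage_cost_le:
  assumes "up_right \<eta> m" "i \<le> j" "j \<le> m"
  shows "passage_cost \<omega> (\<eta> i) (\<eta> j) \<le> (\<Sum>k=i..<j. 1 - \<omega> (\<eta> k))"
proof -
  have l: "l1 (\<eta> j - \<eta> i) = j - i" by (rule up_right_l1[OF assms])
  define \<gamma> where "\<gamma> k = \<eta> (i + k)" for k
  have "\<gamma> \<in> up_right_paths (\<eta> i) (\<eta> j)"
    using assms by (auto simp: up_right_paths_alt l \<gamma>_def up_right_def)
  then have "(\<Sum>k<j - i. \<omega> (\<gamma> k)) \<le> last_passage \<omega> (\<eta> i) (\<eta> j)"
    unfolding last_passage_def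
    by (intro Max_ge finite_path_values) (force simp: l)
  moreover have "(\<Sum>k<j - i. \<omega> (\<gamma> k)) = (\<Sum>k=i..<j. \<omega> (\<eta> k))"
    using sum.shift_bounds_nat_ivl[of "\<lambda>k. \<omega> (\<eta> k)" 0 i "j - i"] assms
    by (simp add: \<gamma>_def atLeast0LessThan add.commute)
  ultimately show ?thesis
    using assms by (simp add: passage_cost_def l sum_subtractf)
qed

lemma passage_cost_attained:
  assumes "x \<le> y"
  obtains \<eta> m where "up_right \<eta> m" "\<eta> 0 = x" "\<eta> m = y"
    "passage_cost \<omega> x y = (\<Sum>k<m. 1 - \<omega> (\<eta> k))"
proof -
  let ?n = "l1 (y - x)"
  have "last_passage \<omega> x y \<in> (\<lambda>\<gamma>. \<Sum>k < ?n. \<omega> (\<gamma> k)) ` up_right_paths x y"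
    unfolding last_passage_def using ex_up_right_path[OF assms]
    by (intro Max_in finite_path_values) auto
  then obtain \<gamma> where "\<gamma> \<in> up_right_paths x y" "last_passage \<omega> x y = (\<Sum>k < ?n. \<omega> (\<gamma> k))"
    by auto
  then show ?thesis
    by (intro that[of \<gamma> ?n]) (auto simp: up_right_paths_alt passage_cost_def sum_subtractf)
qed

lemma up_right_splice:
  assumes "up_right \<eta> m" "up_right \<gamma> n" "\<eta> m = \<gamma> 0"
  shows "up_right (splice_path \<eta> m \<gamma>) (m + n)"
  unfolding up_right_def
proof (intro allI impI)
  fix k assume k: "k < m + n"
  consider "Suc k < m" | "Suc k = m" | "m \<le> k" by linarith
  then show "splice_path \<eta> m \<gamma> (Suc k) - splice_path \<eta> m \<gamma> k \<in> {e1, e2}"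
  proof cases
    case 2
    then show ?thesis
      using assms by (auto simp: splice_path_def up_right_def)
  qed (use assms k in \<open>auto simp: splice_path_def up_right_def Suc_diff_le\<close>)
qed

lemma sum_splice:
  fixes f :: "site \<Rightarrow> 'a::comm_monoid_add"
  shows "(\<Sum>k<m + n. f (splice_path \<eta> m \<gamma> k)) = (\<Sum>k<m. f (\<eta> k)) + (\<Sum>k<n. f (\<gamma> k))"
proof -
  have "(\<Sum>k<m + n. f (splice_path \<eta> m \<gamma> k)) =
      (\<Sum>k<m. f (splice_path \<eta> m \<gamma> k)) + (\<Sum>k<n. f (splice_path \<eta> m \<gamma> (m + k)))"
    using sum.atLeastLessThan_concat[of 0 m "m + n" "\<lambda>k. f (splice_path \<eta> m \<gamma> k)"]
      sum.shift_bounds_nat_ivl[of "\<lambda>k. f (splice_path \<eta> m \<gamma> k)" 0 m n]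
    by (simp add: atLeast0LessThan add.commute)
  then show ?thesis by (simp add: splice_path_def)
qed

lemma passage_cost_triangle:
  assumes "x \<le> y" "y \<le> z"
  shows "passage_cost \<omega> x z \<le> passage_cost \<omega> x y + passage_cost \<omega> y z"
proof -
  obtain \<eta> m where 1: "up_right \<eta> m" "\<eta> 0 = x" "\<eta> m = y"
    "passage_cost \<omega> x y = (\<Sum>k<m. 1 - \<omega> (\<eta> k))" by (rule passage_cost_attained[OF assms(1)])
  obtain \<gamma> n where 2: "up_right \<gamma> n" "\<gamma> 0 = y" "\<gamma> n = z"
    "passage_cost \<omega> y z = (\<Sum>k<n. 1 - \<omega> (\<gamma> k))" by (rule passage_cost_attained[OF assms(2)])
  let ?\<zeta> = "splice_path \<eta> m \<gamma>"
  have "?\<zeta> 0 = x" "?\<zeta> (m + n) = z"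
    using 1 2 by (auto simp: splice_path_def)
  then show ?thesis
    using passage_cost_le[OF up_right_splice[OF 1(1) 2(1)], of 0 "m + n" \<omega>] 1 2
      sum_splice[of "\<lambda>x. 1 - \<omega> x" \<eta> m \<gamma> n]
    by (simp add: atLeast0LessThan)
qed

lemma passage_cost_nonneg:
  assumes "\<And>x. \<omega> x \<le> 1" "x \<le> y"
  shows "0 \<le> passage_cost \<omega> x y"
  by (rule passage_cost_attained[OF assms(2), of \<omega>]) (simp add: sum_nonneg assms(1))

lemma infinite_up_right_paths_translate:
  "infinite_up_right_paths x = (\<lambda>\<gamma> k. x + \<gamma> k) ` infinite_up_right_paths 0"
proof (intro equalityI subsetI)
  fix \<gamma> assume "\<gamma> \<in> infinite_up_right_paths x"
  then have "(\<lambda>k. \<gamma> k - x) \<in> infinite_up_right_paths 0"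
    by (auto simp: infinite_up_right_paths_def)
  then show "\<gamma> \<in> (\<lambda>\<gamma> k. x + \<gamma> k) ` infinite_up_right_paths 0"
    by (rule rev_image_eqI) auto
qed (auto simp: infinite_up_right_paths_def)

lemma psi_translate:
  "psi (translate x \<omega>) = (INF \<gamma> \<in> infinite_up_right_paths x. \<Sum>k. ereal (1 - \<omega> (\<gamma> k)))"
  unfolding infinite_up_right_paths_translate[of x]
  by (simp add: psi_def translate_def image_image)

lemma percolates_translate:
  "percolates (\<lambda>z. \<sigma> (x + z)) 0 \<longleftrightarrow> percolates \<sigma> x"
  unfolding percolates_def infinite_up_right_paths_translate[of x] by simp

text \<open>
  Planarity, in the only form needed: at equal levels the horizontal distance of two up-right paths
  changes by at most one per step, so by the discrete intermediate value theorem they cannot change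
  sides without sharing a site.
\<close>
lemma paths_meet:
  assumes \<alpha>: "up_right \<alpha> m" and \<xi>: "\<And>n. up_right \<xi> n"
    and lev: "level (\<alpha> 0) = level (\<xi> s)"
    and sides: "(fst (\<alpha> 0) \<le> fst (\<xi> s) \<and> fst (\<xi> (s + m)) \<le> fst (\<alpha> m)) \<or>
                (fst (\<xi> s) \<le> fst (\<alpha> 0) \<and> fst (\<alpha> m) \<le> fst (\<xi> (s + m)))"
  shows "\<exists>k\<le>m. \<alpha> k = \<xi> (s + k)"
proof -
  define d where "d k = fst (\<alpha> k) - fst (\<xi> (s + k))" for k
  have step: "\<bar>d (i + 1) - d i\<bar> \<le> 1" if "i < m" for i
  proof -
    have "\<alpha> (Suc i) - \<alpha> i \<in> {e1, e2}" using \<alpha> that by (simp add: up_right_def)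
    note a = step_cases[OF this]
    have "\<xi> (Suc (s + i)) - \<xi> (s + i) \<in> {e1, e2}"
      using \<xi>[of "Suc (s + i)"] unfolding up_right_def by blast
    note b = step_cases[OF this]
    from a b show ?thesis by (auto simp: d_def)
  qed
  have "\<exists>k\<le>m. d k = 0"
  proof (cases "d 0 \<le> 0 \<and> 0 \<le> d m")
    case True
    then show ?thesis using nat0_intermed_int_val[of m d 0] step by auto
  next
    case False
    then have "d 0 \<ge> 0 \<and> 0 \<ge> d m" using sides by (auto simp: d_def)
    then show ?thesis using nat0_intermed_int_val[of m "\<lambda>k. - d k" 0] step by force
  qed
  then obtain k where k: "k \<le> m" "d k = 0" by blast
  have "level (\<alpha> k) = level (\<alpha> 0) + int k"
    using up_right_mono(2)[OF \<alpha>, of 0 k] k by simp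
  moreover have "level (\<xi> (s + k)) = level (\<xi> s) + int k"
    using up_right_mono(2)[OF \<xi>, of s "s + k" "s + k"] by simp
  ultimately have "\<alpha> k = \<xi> (s + k)"
    using k(2) lev by (auto simp: d_def level_def prod_eq_iff)
  then show ?thesis using k by blast
qed

section \<open>Busemann functions along open rays\<close>

definition open_ray :: "env \<Rightarrow> (nat \<Rightarrow> site) \<Rightarrow> bool" where
  "open_ray \<omega> \<gamma> \<longleftrightarrow> (\<forall>m. up_right \<gamma> m) \<and> (\<forall>k. \<omega> (\<gamma> k) = 1)"

lemma percolates_iff_open_ray:
  "percolates (\<lambda>x. \<omega> x = 1) u \<longleftrightarrow> (\<exists>\<gamma>. open_ray \<omega> \<gamma> \<and> \<gamma> 0 = u)"
  unfolding percolates_def Bex_def infinite_up_right_paths_alt open_ray_def by blast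

text \<open>
  Along an open ray the passage costs are eventually nonincreasing and bounded below by \<open>0\<close>, so the
  limit exists once the environment is as in the following locale.
\<close>
definition ray_cost :: "env \<Rightarrow> (nat \<Rightarrow> site) \<Rightarrow> site \<Rightarrow> real" where
  "ray_cost \<omega> \<gamma> x = lim (\<lambda>n. passage_cost \<omega> x (\<gamma> n))"

text \<open>
  The almost sure properties of an environment from which the formula follows without any further
  probability.  Here \<open>b\<close> is the edge speed and \<open>C\<close> the Busemann function of the fixed environment.
  Together with the level condition, the last two assumptions make the percolating sites lie strictly
  to the left, respectively to the right, of every up-right path from \<open>x\<close>.
\<close>
locale typical_environment =
  fixes \<omega> :: env and b :: real and C :: "site \<Rightarrow> site \<Rightarrow> real"
  assumes le_1: "\<omega> x \<le> 1"
    and busemann: "cone_sequence b v \<Longrightarrow>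
      (\<lambda>n. last_passage \<omega> x (v n) - last_passage \<omega> y (v n)) \<longlonglongrightarrow> C x y"
    and ray_unbounded: "open_ray \<omega> \<gamma> \<Longrightarrow> \<exists>n. x \<le> \<gamma> n"
    and ray_in_cone: "open_ray \<omega> \<gamma> \<Longrightarrow> 0 \<le> \<gamma> N \<Longrightarrow> cone_sequence b (\<lambda>n. \<gamma> (n + N))"
    and percolates_left: "\<exists>u. percolates (\<lambda>x. \<omega> x = 1) u \<and> fst u < fst x \<and> level x \<le> level u"
    and percolates_below: "\<exists>v. percolates (\<lambda>x. \<omega> x = 1) v \<and> snd v < snd x \<and> level x \<le> level v"
begin

lemma ray_mono: "open_ray \<omega> \<gamma> \<Longrightarrow> i \<le> j \<Longrightarrow> \<gamma> i \<le> \<gamma> j"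
  using up_right_mono(1)[of \<gamma> j i j] by (simp add: open_ray_def)

lemma ray_eventually_above:
  assumes "open_ray \<omega> \<gamma>"
  obtains N where "\<And>n. n \<ge> N \<Longrightarrow> x \<le> \<gamma> n"
proof -
  obtain N where "x \<le> \<gamma> N" using ray_unbounded[OF assms] by blast
  then show ?thesis using ray_mono[OF assms] order_trans by (intro that[of N]) blast
qed

lemma passage_cost_along_ray:
  assumes "open_ray \<omega> \<gamma>" "i \<le> j"
  shows "passage_cost \<omega> (\<gamma> i) (\<gamma> j) = 0"
proof (rule antisym)
  show "passage_cost \<omega> (\<gamma> i) (\<gamma> j) \<le> 0"
    using passage_cost_le[of \<gamma> j i j \<omega>] assms by (simp add: open_ray_def)
qed (use passage_cost_nonneg le_1 ray_mono assms in blast)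

lemma passage_cost_ray_decreasing:
  assumes "open_ray \<omega> \<gamma>" "i \<le> j" "x \<le> \<gamma> i"
  shows "passage_cost \<omega> x (\<gamma> j) \<le> passage_cost \<omega> x (\<gamma> i)"
  using passage_cost_triangle[of x "\<gamma> i" "\<gamma> j" \<omega>] passage_cost_along_ray[of \<gamma> i j]
    ray_mono[of \<gamma> i j] assms by simp

lemma ray_cost_lim:
  assumes "open_ray \<omega> \<gamma>"
  shows "(\<lambda>n. passage_cost \<omega> x (\<gamma> n)) \<longlonglongrightarrow> ray_cost \<omega> \<gamma> x"
proof -
  obtain N where N: "\<And>n. n \<ge> N \<Longrightarrow> x \<le> \<gamma> n" using ray_eventually_above[OF assms] by blast
  have "decseq (\<lambda>n. passage_cost \<omega> x (\<gamma> (n + N)))"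
    using passage_cost_ray_decreasing[OF assms] N by (auto simp: decseq_def)
  moreover have "0 \<le> passage_cost \<omega> x (\<gamma> (n + N))" for n
    using passage_cost_nonneg[OF le_1] N by simp
  ultimately obtain L where "(\<lambda>n. passage_cost \<omega> x (\<gamma> (n + N))) \<longlonglongrightarrow> L"
    by (metis decseq_convergent)
  then have "(\<lambda>n. passage_cost \<omega> x (\<gamma> n)) \<longlonglongrightarrow> L"
    by (rule LIMSEQ_offset)
  then have "convergent (\<lambda>n. passage_cost \<omega> x (\<gamma> n))"
    by (rule convergentI)
  then show ?thesis by (simp add: ray_cost_def convergent_LIMSEQ_iff)
qed

lemma ray_cost_nonneg:
  assumes "open_ray \<omega> \<gamma>"
  shows "0 \<le> ray_cost \<omega> \<gamma> x"
proof -
  obtain N where "\<And>n. n \<ge> N \<Longrightarrow> x \<le> \<gamma> n" using ray_eventually_above[OF assms] by blast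
  then have "\<forall>n\<ge>N. 0 \<le> passage_cost \<omega> x (\<gamma> n)"
    using passage_cost_nonneg[OF le_1] by simp
  then show ?thesis
    using LIMSEQ_le_const[OF ray_cost_lim[OF assms]] by blast
qed

lemma ray_cost_le:
  assumes "open_ray \<omega> \<gamma>" "x \<le> \<gamma> n"
  shows "ray_cost \<omega> \<gamma> x \<le> passage_cost \<omega> x (\<gamma> n)"
  using LIMSEQ_le_const2[OF ray_cost_lim[OF assms(1)]]
    passage_cost_ray_decreasing[OF assms(1) _ assms(2)] by blast

lemma ray_cost_start:
  assumes "open_ray \<omega> \<gamma>"
  shows "ray_cost \<omega> \<gamma> (\<gamma> 0) = 0"
  using ray_cost_le[OF assms, of "\<gamma> 0" 0] ray_cost_nonneg[OF assms, of "\<gamma> 0"]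
    passage_cost_along_ray[OF assms, of 0 0] by simp

text \<open>
  Open rays are eventually nonnegative cone sequences, and the path lengths contribute the level
  difference.
\<close>
lemma busemann_eq_ray_cost:
  assumes "open_ray \<omega> \<gamma>"
  shows "C x y = real_of_int (level y - level x) + ray_cost \<omega> \<gamma> y - ray_cost \<omega> \<gamma> x"
proof -
  obtain N0 where N0: "\<And>n. n \<ge> N0 \<Longrightarrow> 0 \<le> \<gamma> n" using ray_eventually_above[OF assms] by blast
  obtain Nx where Nx: "\<And>n. n \<ge> Nx \<Longrightarrow> x \<le> \<gamma> n" using ray_eventually_above[OF assms] by blast
  obtain Ny where Ny: "\<And>n. n \<ge> Ny \<Longrightarrow> y \<le> \<gamma> n" using ray_eventually_above[OF assms] by blast
  have "(\<lambda>n. last_passage \<omega> x (\<gamma> (n + N0)) - last_passage \<omega> y (\<gamma> (n + N0))) \<longlonglongrightarrow> C x y"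
    using busemann[OF ray_in_cone[OF assms N0[OF order.refl]]] .
  then have 1: "(\<lambda>n. last_passage \<omega> x (\<gamma> n) - last_passage \<omega> y (\<gamma> n)) \<longlonglongrightarrow> C x y"
    by (rule LIMSEQ_offset)
  have "(\<lambda>n. real_of_int (level y - level x) + passage_cost \<omega> y (\<gamma> n) - passage_cost \<omega> x (\<gamma> n))
      \<longlonglongrightarrow> real_of_int (level y - level x) + ray_cost \<omega> \<gamma> y - ray_cost \<omega> \<gamma> x"
    by (intro tendsto_intros ray_cost_lim assms)
  moreover have "eventually (\<lambda>n. real_of_int (level y - level x) + passage_cost \<omega> y (\<gamma> n)
      - passage_cost \<omega> x (\<gamma> n) = last_passage \<omega> x (\<gamma> n) - last_passage \<omega> y (\<gamma> n)) sequentially"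
    using eventually_ge_at_top[of "max Nx Ny"]
  proof eventually_elim
    case (elim n)
    have "real (l1 (\<gamma> n - x)) = real_of_int (level (\<gamma> n) - level x)"
      using l1_eq_level[OF Nx, of n] elim by simp
    moreover have "real (l1 (\<gamma> n - y)) = real_of_int (level (\<gamma> n) - level y)"
      using l1_eq_level[OF Ny, of n] elim by simp
    ultimately show ?case by (simp add: passage_cost_def)
  qed
  ultimately have "(\<lambda>n. last_passage \<omega> x (\<gamma> n) - last_passage \<omega> y (\<gamma> n))
      \<longlonglongrightarrow> real_of_int (level y - level x) + ray_cost \<omega> \<gamma> y - ray_cost \<omega> \<gamma> x"
    by (rule Lim_transform_eventually)
  then show ?thesis using 1 LIMSEQ_unique by blast
qed

text \<open>
  Evaluating \<open>C\<close> between the two starting points along each of the two rays shows that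
  the cost from the start of \<open>\<gamma>'\<close> to \<open>\<gamma>\<close> is minus the cost from the start of \<open>\<gamma>\<close> to \<open>\<gamma>'\<close>.  Two
  nonnegative numbers with this property are zero, although the rays need not intersect.
\<close>
lemma ray_cost_percolating:
  assumes "open_ray \<omega> \<gamma>" "open_ray \<omega> \<gamma>'"
  shows "ray_cost \<omega> \<gamma> (\<gamma>' 0) = 0"
proof -
  have "ray_cost \<omega> \<gamma> (\<gamma>' 0) = - ray_cost \<omega> \<gamma>' (\<gamma> 0)"
    using busemann_eq_ray_cost[OF assms(1), of "\<gamma> 0" "\<gamma>' 0"]
      busemann_eq_ray_cost[OF assms(2), of "\<gamma> 0" "\<gamma>' 0"]
      ray_cost_start[OF assms(1)] ray_cost_start[OF assms(2)] by simp
  then show ?thesis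
    using ray_cost_nonneg[OF assms(1), of "\<gamma>' 0"] ray_cost_nonneg[OF assms(2), of "\<gamma> 0"] by simp
qed

text \<open>
  Differences of \<open>ray_cost\<close> are determined by \<open>C\<close>, and the additive constant is fixed because both
  functions vanish at the start of \<open>\<gamma>'\<close>.
\<close>
lemma ray_cost_unique:
  assumes "open_ray \<omega> \<gamma>" "open_ray \<omega> \<gamma>'"
  shows "ray_cost \<omega> \<gamma> x = ray_cost \<omega> \<gamma>' x"
  using busemann_eq_ray_cost[OF assms(1), of x "\<gamma>' 0"] busemann_eq_ray_cost[OF assms(2), of x "\<gamma>' 0"]
    ray_cost_percolating[OF assms] ray_cost_start[OF assms(2)] by simp

text \<open>
  An optimal path to a site of \<open>\<gamma>\<close>, continued for free along \<open>\<gamma>\<close>, competes in the infimum.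
\<close>
lemma psi_le_ray_cost:
  assumes "open_ray \<omega> \<gamma>"
  shows "psi (translate x \<omega>) \<le> ereal (ray_cost \<omega> \<gamma> x)"
proof -
  obtain N where N: "\<And>n. n \<ge> N \<Longrightarrow> x \<le> \<gamma> n" using ray_eventually_above[OF assms] by blast
  have "psi (translate x \<omega>) \<le> ereal (passage_cost \<omega> x (\<gamma> n))" if n: "n \<ge> N" for n
  proof -
    obtain \<eta> m where \<eta>: "up_right \<eta> m" "\<eta> 0 = x" "\<eta> m = \<gamma> n"
      "passage_cost \<omega> x (\<gamma> n) = (\<Sum>k<m. 1 - \<omega> (\<eta> k))"
      by (rule passage_cost_attained[OF N[OF n]])
    define \<zeta> where "\<zeta> = splice_path \<eta> m (\<lambda>k. \<gamma> (n + k))"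
    have "up_right \<gamma> (n + k)" for k using assms by (simp add: open_ray_def)
    then have tail: "up_right (\<lambda>k. \<gamma> (n + k)) k" for k
      by (force simp: up_right_def)
    have "up_right \<zeta> (m + k)" for k
      unfolding \<zeta>_def by (rule up_right_splice[OF \<eta>(1) tail]) (simp add: \<eta>(3))
    then have "up_right \<zeta> k" for k
      using le_add2[of k m] less_le_trans unfolding up_right_def by blast
    moreover have "\<zeta> 0 = x" using \<eta> by (auto simp: \<zeta>_def splice_path_def)
    ultimately have "\<zeta> \<in> infinite_up_right_paths x"
      by (simp add: infinite_up_right_paths_alt)
    then have "psi (translate x \<omega>) \<le> (\<Sum>k. ereal (1 - \<omega> (\<zeta> k)))"
      unfolding psi_translate by (rule INF_lower)
    also have "\<dots> = (\<Sum>k<m. ereal (1 - \<omega> (\<zeta> k)))"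
      using assms by (intro suminf_finite) (auto simp: \<zeta>_def splice_path_def open_ray_def)
    also have "\<dots> = ereal (passage_cost \<omega> x (\<gamma> n))"
      by (simp add: \<eta>(4) \<zeta>_def splice_path_def)
    finally show ?thesis .
  qed
  then show ?thesis
    using LIMSEQ_le_const[OF tendsto_ereal[OF ray_cost_lim[OF assms]]] by blast
qed

text \<open>
  The ray \<open>\<gamma>\<close> starts to the right of \<open>\<xi>\<close>.  Either \<open>\<gamma>\<close> meets \<open>\<xi>\<close>, and then it
  is reached for free from the meeting point, or a nearly free path to \<open>\<gamma>\<close> from a percolating site on
  the left of \<open>\<xi>\<close> has to meet \<open>\<xi>\<close>.
\<close>
lemma ray_cost_below_le_path_cost:
  assumes \<gamma>: "open_ray \<omega> \<gamma>" and below: "snd (\<gamma> 0) < snd x" "level x \<le> level (\<gamma> 0)"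
    and \<xi>: "\<xi> \<in> infinite_up_right_paths x"
  shows "ereal (ray_cost \<omega> \<gamma> x) \<le> (\<Sum>k. ereal (1 - \<omega> (\<xi> k)))"
proof (rule ereal_le_epsilon2)
  fix \<epsilon> :: real assume \<epsilon>: "\<epsilon> > 0"
    have \<xi>_path: "up_right \<xi> k" and \<xi>0: "\<xi> 0 = x" for k
      using \<xi> by (auto simp: infinite_up_right_paths_alt)
    have \<xi>_above: "x \<le> \<xi> k" and \<xi>_level: "level (\<xi> k) = level x + int k" for k
      using up_right_mono[OF \<xi>_path, of 0 k k] \<xi>0 by auto
    obtain u \<gamma>' where \<gamma>': "open_ray \<omega> \<gamma>'" "\<gamma>' 0 = u" and u: "fst u < fst x" "level x \<le> level u"
      using percolates_left[of x] by (auto simp: percolates_iff_open_ray)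
    obtain N where N: "\<And>n. n \<ge> N \<Longrightarrow> u \<le> \<gamma> n" using ray_eventually_above[OF \<gamma>] by blast
    have "(\<lambda>n. passage_cost \<omega> u (\<gamma> n)) \<longlonglongrightarrow> 0"
      using ray_cost_lim[OF \<gamma>, of u] ray_cost_percolating[OF \<gamma> \<gamma>'(1)] \<gamma>'(2) by simp
    then have "eventually (\<lambda>n. passage_cost \<omega> u (\<gamma> n) < \<epsilon>) sequentially"
      using \<epsilon> by (rule order_tendstoD)
    then have "eventually (\<lambda>n. passage_cost \<omega> u (\<gamma> n) < \<epsilon> \<and> n \<ge> N) sequentially"
      using eventually_ge_at_top by (rule eventually_conj)
    then obtain n where n: "passage_cost \<omega> u (\<gamma> n) < \<epsilon>" "n \<ge> N"
      using eventually_happens'[OF sequentially_bot] by blast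
    obtain \<eta> m where \<eta>: "up_right \<eta> m" "\<eta> 0 = u" "\<eta> m = \<gamma> n"
      "passage_cost \<omega> u (\<gamma> n) = (\<Sum>k<m. 1 - \<omega> (\<eta> k))"
      by (rule passage_cost_attained[OF N[OF n(2)]])
    have \<gamma>_path: "up_right \<gamma> n" using \<gamma> by (simp add: open_ray_def)
    \<comment> \<open>\<open>s\<close> and \<open>t\<close> are the times at which \<open>\<xi>\<close> is level with \<open>u\<close> and with the start of \<open>\<gamma>\<close>.\<close>
    define s where "s = nat (level u - level x)"
    define t where "t = nat (level (\<gamma> 0) - level x)"
    have s: "level (\<xi> s) = level u" and t: "level (\<xi> t) = level (\<gamma> 0)"
      using u below by (auto simp: s_def t_def \<xi>_level)
    have st: "s + m = t + n"
      using up_right_mono(2)[OF \<eta>(1), of 0 m] up_right_mono(2)[OF \<gamma>_path, of 0 n] s t \<eta>(2,3)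
      by (simp add: \<xi>_level)
    have left: "fst u \<le> fst (\<xi> s)"
      using u \<xi>_above[of s] by (simp add: less_eq_prod_def)
    have right: "fst (\<xi> t) \<le> fst (\<gamma> 0)"
      using below(1) \<xi>_above[of t] t by (simp add: less_eq_prod_def level_def)
    have "\<exists>j. \<xi> j \<le> \<gamma> n \<and> passage_cost \<omega> (\<xi> j) (\<gamma> n) \<le> \<epsilon>"
    proof (cases "fst (\<xi> (s + m)) \<le> fst (\<gamma> n)")
      case True
      then obtain k where k: "k \<le> m" "\<eta> k = \<xi> (s + k)"
        using paths_meet[OF \<eta>(1) \<xi>_path, of s] \<eta>(2,3) s left by auto
      have "passage_cost \<omega> (\<eta> k) (\<gamma> n) \<le> (\<Sum>i=k..<m. 1 - \<omega> (\<eta> i))"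
        using passage_cost_le[OF \<eta>(1) k(1), of \<omega>] \<eta>(3) by simp
      also have "\<dots> \<le> (\<Sum>i<m. 1 - \<omega> (\<eta> i))"
        by (rule sum_mono2) (auto simp: le_1)
      finally show ?thesis
        using n \<eta>(4) k up_right_mono(1)[OF \<eta>(1) k(1)] \<eta>(3) by fastforce
    next
      case False
      then obtain k where "k \<le> n" "\<gamma> k = \<xi> (t + k)"
        using paths_meet[OF \<gamma>_path \<xi>_path, of t] t right st by auto
      then show ?thesis
        using passage_cost_along_ray[OF \<gamma>, of k n] ray_mono[OF \<gamma>, of k n] \<epsilon>
        by (intro exI[of _ "t + k"]) auto
    qed
    then obtain j where j: "\<xi> j \<le> \<gamma> n" "passage_cost \<omega> (\<xi> j) (\<gamma> n) \<le> \<epsilon>" by blast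
    have "ray_cost \<omega> \<gamma> x \<le> passage_cost \<omega> x (\<gamma> n)"
      using order_trans[OF \<xi>_above j(1)] by (rule ray_cost_le[OF \<gamma>])
    also have "\<dots> \<le> passage_cost \<omega> x (\<xi> j) + \<epsilon>"
      using passage_cost_triangle[OF \<xi>_above j(1), of \<omega>] j(2) by simp
    also have "\<dots> \<le> (\<Sum>k<j. 1 - \<omega> (\<xi> k)) + \<epsilon>"
      using passage_cost_le[OF \<xi>_path, of 0 j j \<omega>] \<xi>0 by (simp add: atLeast0LessThan)
    finally have "ereal (ray_cost \<omega> \<gamma> x) \<le> (\<Sum>k<j. ereal (1 - \<omega> (\<xi> k))) + ereal \<epsilon>"
      by simp
    also have "\<dots> \<le> (\<Sum>k. ereal (1 - \<omega> (\<xi> k))) + ereal \<epsilon>"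
      by (intro add_right_mono suminf_upper) (simp add: le_1)
    finally show "ereal (ray_cost \<omega> \<gamma> x) \<le> (\<Sum>k. ereal (1 - \<omega> (\<xi> k))) + ereal \<epsilon>" .
qed

lemma psi_eq_ray_cost:
  assumes "open_ray \<omega> \<gamma>"
  shows "psi (translate x \<omega>) = ereal (ray_cost \<omega> \<gamma> x)"
proof (rule antisym)
  obtain \<gamma>' where \<gamma>': "open_ray \<omega> \<gamma>'" "snd (\<gamma>' 0) < snd x" "level x \<le> level (\<gamma>' 0)"
    using percolates_below[of x] by (auto simp: percolates_iff_open_ray)
  show "ereal (ray_cost \<omega> \<gamma> x) \<le> psi (translate x \<omega>)"
    unfolding psi_translate ray_cost_unique[OF assms \<gamma>'(1)]
    using ray_cost_below_le_path_cost[OF \<gamma>'] by (rule INF_greatest)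
qed (rule psi_le_ray_cost[OF assms])

lemma busemann_eq_psi:
  "\<bar>psi (translate x \<omega>)\<bar> \<noteq> \<infinity> \<and>
   C x y = real_of_int (fst (y - x) + snd (y - x))
     + real_of_ereal (psi (translate y \<omega>)) - real_of_ereal (psi (translate x \<omega>))"
proof -
  obtain \<gamma> where \<gamma>: "open_ray \<omega> \<gamma>"
    using percolates_left[of 0] by (auto simp: percolates_iff_open_ray)
  show ?thesis
    using busemann_eq_ray_cost[OF \<gamma>, of x y] by (simp add: psi_eq_ray_cost[OF \<gamma>] level_def)
qed

end

section \<open>Open rays and the percolation cone\<close>

text \<open>
  A ray with finitely many right steps would end in an open vertical half-line.
\<close>
lemma open_ray_turns_right:
  assumes no_vertical: "\<And>y. \<exists>k. \<omega> (y + (0, int k)) \<noteq> 1" and ray: "open_ray \<omega> \<gamma>"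
  shows "\<exists>n. fst (\<gamma> 0) + int K \<le> fst (\<gamma> n)"
proof (induction K)
  case (Suc K)
  then obtain m where m: "fst (\<gamma> 0) + int K \<le> fst (\<gamma> m)" by blast
  have "\<exists>k. fst (\<gamma> (m + Suc k)) \<noteq> fst (\<gamma> (m + k))"
  proof (rule ccontr)
    assume "\<not> ?thesis"
    then have const: "fst (\<gamma> (m + Suc k)) = fst (\<gamma> (m + k))" for k by blast
    have "\<gamma> (m + k) = \<gamma> m + (0, int k)" for k
    proof (induction k)
      case (Suc k)
      have "\<gamma> (Suc (m + k)) - \<gamma> (m + k) \<in> {e1, e2}"
        using ray unfolding open_ray_def up_right_def by blast
      from step_cases[OF this] show ?case
        using Suc const[of k] by (auto simp: prod_eq_iff)
    qed (simp add: prod_eq_iff)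
    moreover obtain k where "\<omega> (\<gamma> m + (0, int k)) \<noteq> 1" using no_vertical by blast
    ultimately show False using ray by (metis open_ray_def)
  qed
  then obtain k where k: "fst (\<gamma> (m + Suc k)) \<noteq> fst (\<gamma> (m + k))" by blast
  have "\<gamma> (Suc (m + k)) - \<gamma> (m + k) \<in> {e1, e2}"
    using ray unfolding open_ray_def up_right_def by blast
  from step_cases[OF this] k have "fst (\<gamma> (m + Suc k)) = fst (\<gamma> (m + k)) + 1" by auto
  moreover have "fst (\<gamma> m) \<le> fst (\<gamma> (m + k))"
    using up_right_mono(1)[of \<gamma> "m + k" m "m + k"] ray
    by (simp add: open_ray_def less_eq_prod_def)
  ultimately show ?case using m by (intro exI[of _ "m + Suc k"]) simp
qed auto

lemma swap_step: "prod.swap z - prod.swap y \<in> {e1, e2} \<longleftrightarrow> z - y \<in> {e1, e2}"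
  by (cases z; cases y) (auto simp: e1_def e2_def)

lemma open_ray_swap:
  "open_ray \<omega> \<gamma> \<Longrightarrow> open_ray (\<omega> \<circ> prod.swap) (prod.swap \<circ> \<gamma>)"
  by (auto simp: open_ray_def up_right_def swap_step[simplified])

lemma percolates_swap:
  assumes "percolates (\<lambda>z. \<sigma> (x + prod.swap z)) u"
  shows "percolates \<sigma> (x + prod.swap u)"
proof -
  obtain \<gamma> where "\<gamma> \<in> infinite_up_right_paths u" "\<forall>k. \<sigma> (x + prod.swap (\<gamma> k))"
    using assms unfolding percolates_def by blast
  then show ?thesis
    unfolding percolates_def
    by (intro bexI[of _ "\<lambda>k. x + prod.swap (\<gamma> k)"])
      (auto simp: infinite_up_right_paths_def swap_step[simplified])
qed

lemma open_ray_unbounded: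
  assumes no_vertical: "\<And>y. \<exists>k. \<omega> (y + (0, int k)) \<noteq> 1"
    and no_horizontal: "\<And>y. \<exists>k. \<omega> (y + (int k, 0)) \<noteq> 1" and ray: "open_ray \<omega> \<gamma>"
  shows "\<exists>n. x \<le> \<gamma> n"
proof -
  obtain m where m: "fst (\<gamma> 0) + int (nat (fst x - fst (\<gamma> 0))) \<le> fst (\<gamma> m)"
    using open_ray_turns_right[OF no_vertical ray] by blast
  have "\<exists>k. (\<omega> \<circ> prod.swap) (y + (0, int k)) \<noteq> 1" for y
    using no_horizontal[of "prod.swap y"] by (cases y) auto
  from open_ray_turns_right[OF this open_ray_swap[OF ray]]
  obtain n where n: "snd (\<gamma> 0) + int (nat (snd x - snd (\<gamma> 0))) \<le> snd (\<gamma> n)"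
    by (metis comp_apply fst_swap)
  have "\<gamma> m \<le> \<gamma> (max m n)" "\<gamma> n \<le> \<gamma> (max m n)"
    using up_right_mono(1)[of \<gamma> "max m n"] ray by (auto simp: open_ray_def)
  then have "x \<le> \<gamma> (max m n)"
    using m n unfolding less_eq_prod_def by linarith
  then show ?thesis ..
qed

lemma open_path_below_right_edge:
  assumes path: "\<And>m. up_right \<delta> m" and start: "\<delta> 0 = 0" and open_sites: "\<And>k. \<sigma> (\<delta> k)"
  shows "fst (\<delta> n) \<le> right_edge \<sigma> n"
  unfolding right_edge_def
proof (rule Max_ge)
  let ?R = "{fst u |u. 0 \<le> fst u \<and> 0 \<le> snd u \<and> l1 u = n \<and> open_connected \<sigma> 0 u}"
  have "?R \<subseteq> {0..int n}" by (auto simp: l1_def)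
  then show "finite ?R" by (rule finite_subset) simp
  have l: "l1 (\<delta> n) = n" using up_right_l1[OF path, of 0 n n] start by simp
  then have "\<delta> \<in> up_right_paths 0 (\<delta> n)"
    using path start by (simp add: up_right_paths_alt)
  then have "open_connected \<sigma> 0 (\<delta> n)" using open_sites unfolding open_connected_def by blast
  moreover have "0 \<le> \<delta> n" using up_right_mono(1)[OF path, of 0 n n] start by simp
  ultimately show "fst (\<delta> n) \<in> ?R" using l by (auto simp: less_eq_prod_def)
qed

text \<open>
  The shifts by \<open>c\<close> and \<open>s\<close> come from rays that do not start at the origin: \<open>c\<close> is a coordinate and \<open>s\<close>
  the level of the starting point.  Both disappear in the limit.
\<close>
lemma limsup_ratio_le:
  fixes g a :: "nat \<Rightarrow> int" and s :: int
  assumes le: "\<And>n. g n \<le> c + a n" and lim: "(\<lambda>n. real_of_int (a n) / real n) \<longlonglongrightarrow> b"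
  shows "limsup (\<lambda>n. ereal (real_of_int (g (n + N)) / real_of_int (int (n + N) + s))) \<le> ereal b"
proof -
  have "(\<lambda>n. (real_of_int c / real n + real_of_int (a n) / real n) * (1 / (1 + real_of_int s / real n)))
      \<longlonglongrightarrow> (0 + b) * (1 / (1 + 0))"
    by (intro tendsto_intros lim lim_const_over_n) simp
  moreover have "eventually (\<lambda>n. (real_of_int c / real n + real_of_int (a n) / real n)
        * (1 / (1 + real_of_int s / real n))
      = real_of_int (c + a n) / real_of_int (int n + s)) sequentially"
    using eventually_gt_at_top[of 0]
  proof eventually_elim
    case (elim n)
    then have "1 + real_of_int s / real n = (real n + real_of_int s) / real n"
      by (simp add: field_simps)
    then show ?case using elim by (simp add: add_divide_distrib[symmetric])
  qed
  ultimately have "(\<lambda>n. real_of_int (c + a n) / real_of_int (int n + s)) \<longlonglongrightarrow> b"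
    using Lim_transform_eventually by force
  then have "(\<lambda>n. ereal (real_of_int (c + a (n + N)) / real_of_int (int (n + N) + s))) \<longlonglongrightarrow> ereal b"
    by (intro tendsto_ereal) (rule LIMSEQ_ignore_initial_segment)
  from lim_imp_Limsup[OF _ this]
  have lim_eq: "limsup (\<lambda>n. ereal (real_of_int (c + a (n + N)) / real_of_int (int (n + N) + s))) = ereal b"
    by simp
  have "eventually (\<lambda>n. ereal (real_of_int (g (n + N)) / real_of_int (int (n + N) + s))
      \<le> ereal (real_of_int (c + a (n + N)) / real_of_int (int (n + N) + s))) sequentially"
    using eventually_ge_at_top[of "nat \<bar>s\<bar>"]
  proof eventually_elim
    case (elim n)
    have "real_of_int (g (n + N)) \<le> real_of_int (c + a (n + N))" using le of_int_le_iff by blast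
    moreover have "0 \<le> real_of_int (int (n + N) + s)" using elim by linarith
    ultimately show ?case by (simp add: divide_right_mono del: of_int_add)
  qed
  then show ?thesis unfolding lim_eq[symmetric] by (rule Limsup_mono)
qed

text \<open>
  The right edge seen from the start of the ray bounds its first coordinate.  The right edge of the
  reflected configuration bounds the second coordinate, and the two
  coordinates of a nonnegative site add up to its norm.
\<close>
lemma open_ray_cone_sequence:
  assumes ray: "open_ray \<omega> \<gamma>" and N: "0 \<le> \<gamma> N"
    and right: "(\<lambda>n. real_of_int (right_edge (\<lambda>z. \<omega> (\<gamma> 0 + z) = 1) n) / real n) \<longlonglongrightarrow> b"
    and top: "(\<lambda>n. real_of_int (right_edge (\<lambda>z. \<omega> (\<gamma> 0 + prod.swap z) = 1) n) / real n) \<longlonglongrightarrow> b"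
  shows "cone_sequence b (\<lambda>n. \<gamma> (n + N))"
proof -
  have path: "up_right \<gamma> m" for m using ray by (simp add: open_ray_def)
  have nonneg: "0 \<le> \<gamma> (n + N)" for n
    using N up_right_mono(1)[OF path, of N "n + N" "n + N"] by simp
  define s where "s = level (\<gamma> 0)"
  have l1: "int (l1 (\<gamma> (n + N))) = int (n + N) + s" for n
    using l1_eq_level[OF nonneg, of n] up_right_mono(2)[OF path, of 0 "n + N" "n + N"]
    by (simp add: s_def level_def)
  have ratio: "real (l1 (\<gamma> (n + N))) = real_of_int (int (n + N) + s)" for n
    using l1[of n] by (metis of_int_of_nat_eq)
  have "fst (\<gamma> n - \<gamma> 0) \<le> right_edge (\<lambda>z. \<omega> (\<gamma> 0 + z) = 1) n" for n
    using ray by (intro open_path_below_right_edge) (auto simp: open_ray_def up_right_def)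
  then have fst_le: "fst (\<gamma> n) \<le> fst (\<gamma> 0) + right_edge (\<lambda>z. \<omega> (\<gamma> 0 + z) = 1) n" for n
    by (simp add: algebra_simps)
  have "fst (prod.swap (\<gamma> n - \<gamma> 0)) \<le> right_edge (\<lambda>z. \<omega> (\<gamma> 0 + prod.swap z) = 1) n" for n
  proof (intro open_path_below_right_edge)
    show "up_right (\<lambda>n. prod.swap (\<gamma> n - \<gamma> 0)) m" for m
      using path[of m] by (auto simp: up_right_def swap_step[simplified])
  qed (use ray in \<open>auto simp: open_ray_def prod_eq_iff\<close>)
  then have snd_le: "snd (\<gamma> n) \<le> snd (\<gamma> 0) + right_edge (\<lambda>z. \<omega> (\<gamma> 0 + prod.swap z) = 1) n" for n
    by (simp add: algebra_simps)
  show ?thesis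
    unfolding cone_sequence_def
  proof (intro conjI allI)
    fix n show "0 \<le> fst (\<gamma> (n + N))" "0 \<le> snd (\<gamma> (n + N))"
      using nonneg[of n] by (auto simp: less_eq_prod_def)
  next
    show "filterlim (\<lambda>n. l1 (\<gamma> (n + N))) at_top sequentially"
      unfolding filterlim_at_top
    proof
      fix Z show "eventually (\<lambda>n. Z \<le> l1 (\<gamma> (n + N))) sequentially"
        using eventually_ge_at_top[of "Z + nat \<bar>s\<bar>"]
      proof eventually_elim
        case (elim n)
        then show ?case using l1[of n] by linarith
      qed
    qed
  next
    show "limsup (\<lambda>n. ereal (real_of_int (fst (\<gamma> (n + N))) / real (l1 (\<gamma> (n + N))))) \<le> ereal b"
      unfolding ratio by (rule limsup_ratio_le[OF fst_le right])
  next
    have "limsup (\<lambda>n. ereal (real_of_int (snd (\<gamma> (n + N))) / real (l1 (\<gamma> (n + N))))) \<le> ereal b"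
      unfolding ratio by (rule limsup_ratio_le[OF snd_le top])
    then have "ereal 1 - ereal b \<le>
        ereal 1 - limsup (\<lambda>n. ereal (real_of_int (snd (\<gamma> (n + N))) / real (l1 (\<gamma> (n + N)))))"
      by (rule ereal_minus_mono[OF order.refl])
    also have "\<dots> = liminf (\<lambda>n. ereal 1 - ereal (real_of_int (snd (\<gamma> (n + N))) / real (l1 (\<gamma> (n + N)))))"
      by (rule liminf_ereal_cminus[symmetric]) auto
    also have "\<dots> \<le> liminf (\<lambda>n. ereal (real_of_int (fst (\<gamma> (n + N))) / real (l1 (\<gamma> (n + N)))))"
    proof (rule Liminf_mono)
      show "eventually (\<lambda>n. ereal 1 - ereal (real_of_int (snd (\<gamma> (n + N))) / real (l1 (\<gamma> (n + N))))
          \<le> ereal (real_of_int (fst (\<gamma> (n + N))) / real (l1 (\<gamma> (n + N))))) sequentially"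
        using eventually_ge_at_top[of "Suc (nat \<bar>s\<bar>)"]
      proof eventually_elim
        case (elim n)
        then have pos: "0 < int (n + N) + s" by linarith
        have "fst (\<gamma> (n + N)) + snd (\<gamma> (n + N)) = int (n + N) + s"
          using up_right_mono(2)[OF path, of 0 "n + N" "n + N"] by (simp add: level_def s_def)
        then have "real_of_int (fst (\<gamma> (n + N))) + real_of_int (snd (\<gamma> (n + N)))
            = real_of_int (int (n + N) + s)" by (metis of_int_add)
        moreover have "real_of_int (int (n + N) + s) \<noteq> 0" using pos of_int_0_less_iff by fastforce
        ultimately have "real_of_int (fst (\<gamma> (n + N))) / real_of_int (int (n + N) + s)
            + real_of_int (snd (\<gamma> (n + N))) / real_of_int (int (n + N) + s) = 1"
          by (metis add_divide_distrib divide_self)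
        then show ?case unfolding ratio by simp
      qed
    qed
    finally show "ereal (1 - b) \<le>
        liminf (\<lambda>n. ereal (real_of_int (fst (\<gamma> (n + N))) / real (l1 (\<gamma> (n + N)))))"
      by simp
  qed
qed

section \<open>Almost sure properties of site percolation\<close>

lemma space_site_percolation [simp]: "space (site_percolation p) = UNIV"
  by (simp add: site_percolation_def space_PiM)

lemma sets_site_percolation:
  "sets (site_percolation p) = sets (PiM UNIV (\<lambda>_. count_space UNIV))"
  unfolding site_percolation_def by (rule sets_PiM_cong) auto

lemma prob_space_site_percolation: "prob_space (site_percolation p)"
  unfolding site_percolation_def
  by (intro prob_space_PiM measure_pmf.prob_space_axioms)

lemma site_percolation_distr_site:
  "distr (site_percolation p) (measure_pmf (bernoulli_pmf p)) (\<lambda>\<sigma>. \<sigma> z) = measure_pmf (bernoulli_pmf p)"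
proof -
  interpret product_prob_space "\<lambda>_::site. measure_pmf (bernoulli_pmf p)" UNIV
    by (intro product_prob_spaceI measure_pmf.prob_space_axioms)
  show ?thesis unfolding site_percolation_def by (rule PiM_component) simp
qed

lemma site_percolation_reindex:
  assumes "inj f"
  shows "distr (site_percolation p) (site_percolation p) (\<lambda>\<sigma> z. \<sigma> (f z)) = site_percolation p"
  using distr_PiM_reindex[OF measure_pmf.prob_space_axioms, of f UNIV UNIV] assms
  by (simp add: site_percolation_def restrict_def)

lemma measurable_site_percolation_reindex:
  "(\<lambda>\<sigma> z. \<sigma> (f z)) \<in> measurable (site_percolation p) (site_percolation p)"
  unfolding site_percolation_def by (rule measurable_PiM_single') (auto simp: space_PiM)

lemma site_percolation_indep_vars:
  "prob_space.indep_vars (site_percolation p) (\<lambda>_. measure_pmf (bernoulli_pmf p)) (\<lambda>z \<sigma>. \<sigma> z) UNIV"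
proof -
  interpret prob_space "site_percolation p" by (rule prob_space_site_percolation)
  have "distr (site_percolation p) (\<Pi>\<^sub>M i\<in>UNIV. measure_pmf (bernoulli_pmf p)) (\<lambda>x. \<lambda>i\<in>UNIV. x i)
     = (\<Pi>\<^sub>M i\<in>UNIV. distr (site_percolation p) (measure_pmf (bernoulli_pmf p)) (\<lambda>\<sigma>. \<sigma> i))"
    unfolding site_percolation_distr_site
    by (simp add: site_percolation_def restrict_def distr_id)
  then show ?thesis
    by (subst indep_vars_iff_distr_eq_PiM') (auto simp: site_percolation_def)
qed

text \<open>
  The first \<open>n\<close> sites are all open with probability \<open>p ^ n\<close>, which tends to zero.
\<close>
lemma AE_site_percolation_closed_on_axis:
  assumes p: "0 \<le> p" "p < 1"
  shows "AE \<sigma> in site_percolation p. \<exists>k. \<not> \<sigma> (int k, 0)"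
proof -
  interpret prob_space "site_percolation p" by (rule prob_space_site_percolation)
  define B where "B n = (\<Inter>z\<in>(\<lambda>k. (int k, 0)) ` {..<n}. (\<lambda>\<sigma>::site \<Rightarrow> bool. \<sigma> z) -` {True})" for n
  have site: "(\<lambda>\<sigma>. \<sigma> z) \<in> measurable (site_percolation p) (measure_pmf (bernoulli_pmf p))" for z
    unfolding site_percolation_def by (rule measurable_component_singleton) simp
  have prob_open: "prob ((\<lambda>\<sigma>. \<sigma> z) -` {True} \<inter> space (site_percolation p)) = p" for z
    using arg_cong[OF site_percolation_distr_site[of p z], of "\<lambda>M. measure M {True}"]
      measure_distr[OF site, of "{True}" z] p
    by (simp add: measure_pmf_single)
  have prob_B: "prob (B (Suc n)) = p ^ Suc n" for n
  proof -
    have "prob (B (Suc n)) = (\<Prod>z\<in>(\<lambda>k. (int k, 0::int)) ` {..<Suc n}. p)"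
      using indep_varsD[OF site_percolation_indep_vars,
        of "(\<lambda>k. (int k, 0)) ` {..<Suc n}" "\<lambda>_. {True}"] prob_open
      by (simp add: B_def lessThan_empty_iff)
    also have "\<dots> = p ^ card ((\<lambda>k. (int k, 0::int)) ` {..<Suc n})" by simp
    also have "card ((\<lambda>k. (int k, 0::int)) ` {..<Suc n}) = Suc n"
      by (subst card_image) (auto simp: inj_on_def)
    finally show ?thesis .
  qed
  let ?A = "\<Inter>n. B (Suc n)"
  have meas: "B (Suc n) \<in> events" for n
    using sets.countable_INT'[of "(\<lambda>k. (int k, 0)) ` {..<Suc n}"
        "\<lambda>z. (\<lambda>\<sigma>. \<sigma> z) -` {True}" "site_percolation p"] measurable_sets[OF site, of "{True}"]
    by (auto simp: B_def)
  have "prob ?A \<le> p ^ Suc n" for n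
    unfolding prob_B[of n, symmetric] by (rule finite_measure_mono[OF _ meas]) auto
  moreover have "(\<lambda>n. p ^ Suc n) \<longlonglongrightarrow> 0"
    using p by (intro LIMSEQ_ignore_initial_segment[of _ _ 1, simplified] LIMSEQ_power_zero) simp
  ultimately have "prob ?A \<le> 0"
    by (intro LIMSEQ_le_const) auto
  then have "prob ?A = 0" using measure_nonneg by (rule antisym)
  moreover have "?A \<in> events" using meas by blast
  ultimately have "AE \<sigma> in site_percolation p. \<sigma> \<notin> ?A"
    by (intro AE_not_in) (simp add: null_sets_def emeasure_eq_measure)
  then show ?thesis
    by eventually_elim (auto simp: B_def)
qed

text \<open>
  Up-right paths never return below their starting row.  Writing the event with the lower half-plane
  closed makes its measurability with respect to the upper rows visible.
\<close>
lemma percolates_restrict_above: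
  "percolates (\<lambda>z. 0 \<le> snd z \<and> \<sigma> z) 0 \<longleftrightarrow> percolates \<sigma> 0"
proof -
  have "0 \<le> snd (\<gamma> k)" if "\<gamma> \<in> infinite_up_right_paths 0" for \<gamma> k
    using up_right_mono(1)[of \<gamma> k 0 k] that
    by (auto simp: infinite_up_right_paths_alt less_eq_prod_def)
  then show ?thesis by (auto simp: percolates_def)
qed

text \<open>
  The events \<open>A k\<close> that \<open>(- k, k)\<close> percolates all have the same positive probability, so infinitely
  many of them occur with positive probability.  As \<open>A k\<close> depends only on the rows at height at least
  \<open>k\<close>, that event is in the tail of the independent rows and has probability one.
\<close>
lemma AE_percolates_on_antidiagonal:
  assumes pos: "measure (site_percolation p) {\<sigma>. percolates \<sigma> 0} \<noteq> 0"
  shows "AE \<sigma> in site_percolation p. \<forall>n. \<exists>k\<ge>n. percolates \<sigma> (- int k, int k)"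
proof -
  let ?M = "site_percolation p"
  interpret prob_space ?M by (rule prob_space_site_percolation)
  let ?S = "{\<sigma>::site \<Rightarrow> bool. percolates \<sigma> 0}"
  \<comment> \<open>A set that is not measurable would get measure zero.\<close>
  have S: "?S \<in> events" using pos measure_notin_sets by blast
  define E :: "site \<Rightarrow> (site \<Rightarrow> bool) set set" where "E z = {(\<lambda>\<sigma>. \<sigma> z) -` B | B. True}" for z
  define F where "F j = sigma_sets UNIV (\<Union>z\<in>{z. snd z = int j}. E z)" for j
  define A where "A k = {\<sigma>. percolates \<sigma> (- int k, int k)}" for k
  have "indep_sets E UNIV"
    using site_percolation_indep_vars[of p] by (simp add: indep_vars_def2 E_def[abs_def])
  then have E_rows: "indep_sets E (\<Union>j\<in>(UNIV :: nat set). {z. snd z = int j})"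
    by (rule indep_sets_mono_index[rotated]) simp
  have E_stable: "Int_stable (E z)" for z
  proof (rule Int_stableI)
    fix a b assume "a \<in> E z" "b \<in> E z"
    then obtain A B where "a = (\<lambda>\<sigma>. \<sigma> z) -` A" "b = (\<lambda>\<sigma>. \<sigma> z) -` B"
      unfolding E_def by blast
    then have "a \<inter> b = (\<lambda>\<sigma>. \<sigma> z) -` (A \<inter> B)" by (simp only: vimage_Int)
    then show "a \<inter> b \<in> E z" unfolding E_def by blast
  qed
  have "disjoint_family_on (\<lambda>j. {z :: site. snd z = int j}) UNIV"
    by (auto simp: disjoint_family_on_def)
  from indep_sets_collect_sigma[OF E_rows E_stable this]
  have indep: "indep_sets F UNIV" by (simp add: F_def[abs_def])
  have tail: "A k \<in> sigma_sets UNIV (\<Union>j\<in>{k..}. F j)" for k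
  proof -
    let ?N = "sigma UNIV (\<Union>j\<in>{k..}. F j)"
    let ?g = "\<lambda>\<sigma> z. 0 \<le> snd z \<and> \<sigma> ((- int k, int k) + z)"
    have "?g \<in> measurable ?N (PiM UNIV (\<lambda>_. count_space UNIV))"
    proof (rule measurable_PiM_single')
      fix z :: site
      show "(\<lambda>\<sigma>. 0 \<le> snd z \<and> \<sigma> ((- int k, int k) + z)) \<in> measurable ?N (count_space UNIV)"
      proof (cases "0 \<le> snd z")
        case True
        let ?w = "(- int k, int k) + z"
        have "(\<lambda>\<sigma>. \<sigma> ?w) -` B \<in> F (k + nat (snd z))" for B
          unfolding F_def using True by (intro sigma_sets.Basic UN_I[of ?w]) (auto simp: E_def)
        then have "(\<lambda>\<sigma>. \<sigma> ?w) -` B \<in> sigma_sets UNIV (\<Union>j\<in>{k..}. F j)" for B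
          by (intro sigma_sets.Basic UN_I[of "k + nat (snd z)"]) auto
        then have "(\<lambda>\<sigma>. \<sigma> ?w) \<in> measurable ?N (count_space UNIV)"
          by (intro measurableI) (auto simp: sets_measure_of)
        then show ?thesis using True by simp
      qed simp
    qed simp
    then have "?g \<in> measurable ?N ?M"
      by (simp add: measurable_cong_sets[OF refl sets_site_percolation])
    from measurable_sets[OF this S] have "?g -` ?S \<in> sets ?N" by simp
    also have "?g -` ?S = A k"
      using percolates_restrict_above[of "\<lambda>z. \<sigma> ((- int k, int k) + z)" for \<sigma>]
      by (simp add: percolates_translate A_def)
    finally show ?thesis by (simp add: sets_measure_of)
  qed
  have F_events: "F j \<subseteq> events" for j using indep by (simp add: indep_sets_def)
  have "sigma_sets UNIV (\<Union>j\<in>{k..}. F j) \<subseteq> events" for k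
    using sets.sigma_sets_subset[of "\<Union>j\<in>{k..}. F j" ?M] F_events by auto
  then have A_event: "A k \<in> events" for k using tail by blast
  have prob_A: "prob (A k) = prob ?S" for k
  proof -
    have "inj (\<lambda>z::site. (- int k, int k) + z)" by (simp add: inj_def)
    from arg_cong[OF site_percolation_reindex[OF this, of p], of "\<lambda>N. measure N ?S"]
    have "prob ?S = prob ((\<lambda>\<sigma> z. \<sigma> ((- int k, int k) + z)) -` ?S \<inter> space ?M)"
      by (simp add: measure_distr[OF measurable_site_percolation_reindex S])
    moreover have "(\<lambda>\<sigma> z. \<sigma> ((- int k, int k) + z)) -` ?S = A k"
      by (simp add: A_def percolates_translate)
    ultimately show ?thesis by simp
  qed
  define L where "L = (\<Inter>n. \<Union>k\<in>{n..}. A k)"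
  have U_event: "(\<Union>k\<in>{n..}. A k) \<in> events" for n using A_event by blast
  have "L \<in> tail_events F"
    unfolding tail_events_def
  proof
    fix n
    let ?T = "sigma_sets UNIV (\<Union>j\<in>{n..}. F j)"
    have sa: "sigma_algebra UNIV ?T" by (rule sigma_algebra_sigma_sets) simp
    have U_tail: "(\<Union>k\<in>{m..}. A k) \<in> ?T" if "m \<ge> n" for m
    proof -
      have A_tail: "A k \<in> ?T" if "k \<ge> m" for k
      proof -
        have "(\<Union>j\<in>{k..}. F j) \<subseteq> (\<Union>j\<in>{n..}. F j)"
          using \<open>m \<ge> n\<close> that by (intro UN_mono) auto
        from sigma_sets_mono'[OF this] show ?thesis using tail by blast
      qed
      show ?thesis
        by (rule sigma_algebra.countable_UN''[OF sa]) (use A_tail in auto)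
    qed
    have "(\<Inter>m. \<Union>k\<in>{m + n..}. A k) \<in> ?T"
      by (rule sigma_algebra.countable_INT[OF sa]) (use U_tail in auto)
    also have "(\<Inter>m. \<Union>k\<in>{m + n..}. A k) = L"
    proof (intro equalityI subsetI)
      fix \<sigma> assume *: "\<sigma> \<in> (\<Inter>m. \<Union>k\<in>{m + n..}. A k)"
      have "\<sigma> \<in> (\<Union>k\<in>{m..}. A k)" for m
      proof -
        obtain k where "k \<ge> m + n" "\<sigma> \<in> A k" using * by blast
        then show ?thesis by auto
      qed
      then show "\<sigma> \<in> L" by (simp add: L_def)
    qed (auto simp: L_def)
    finally show "L \<in> sigma_sets (space ?M) (\<Union> (F ` {n..}))" by simp
  qed
  then have zero_one: "prob L = 0 \<or> prob L = 1"
  proof (rule kolmogorov_0_1_law[rotated 2])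
    show "sigma_algebra (space ?M) (F i)" for i
      unfolding F_def space_site_percolation by (rule sigma_algebra_sigma_sets) simp
  qed (rule indep)
  have "decseq (\<lambda>n. \<Union>k\<in>{n..}. A k)"
    unfolding decseq_def by (intro allI impI UN_mono) auto
  then have "(\<lambda>n. prob (\<Union>k\<in>{n..}. A k)) \<longlonglongrightarrow> prob L"
    unfolding L_def using U_event by (intro finite_Lim_measure_decseq) auto
  moreover have "prob ?S \<le> prob (\<Union>k\<in>{n..}. A k)" for n
    unfolding prob_A[of n, symmetric] by (intro finite_measure_mono U_event) auto
  ultimately have "prob ?S \<le> prob L" by (intro LIMSEQ_le_const) auto
  then have "prob L = 1" using zero_one pos measure_nonneg[of ?M ?S] by linarith
  from AE_prob_1[OF this] show ?thesis
    by eventually_elim (auto simp: L_def A_def)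
qed

lemma percolation_pos_above_critical:
  assumes "critical_probability < p" "0 \<le> p" "p \<le> 1"
  shows "measure (site_percolation p) {\<sigma>. percolates \<sigma> 0} \<noteq> 0"
proof
  let ?C = "{p \<in> {0..1}. measure (site_percolation p)
      {\<sigma> \<in> space (site_percolation p). percolates \<sigma> 0} = 0}"
  assume "measure (site_percolation p) {\<sigma>. percolates \<sigma> 0} = 0"
  then have "p \<in> ?C" using assms by simp
  moreover have "bdd_above ?C" by (rule bdd_aboveI[of _ 1]) auto
  ultimately have "p \<le> Sup ?C" by (rule cSup_upper)
  then show False using assms(1) by (simp add: critical_probability_def)
qed

section \<open>The Busemann function of the percolation cone\<close>

text \<open>
  The sites of weight one form Bernoulli percolation of parameter \<open>p1\<close>, which is where independence
  and identical distribution of the weights enter.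
\<close>
lemma iid_open_sites_distr:
  fixes P :: "env measure"
  assumes P: "prob_space P"
    and indep: "prob_space.indep_vars P (\<lambda>_. borel) (\<lambda>x \<omega>. \<omega> x) (UNIV :: site set)"
    and ident: "\<And>x. distr P borel (\<lambda>\<omega>. \<omega> x) = distr P borel (\<lambda>\<omega>. \<omega> 0)"
    and p1: "p1 = measure P {\<omega> \<in> space P. \<omega> 0 = 1}"
  shows "(\<lambda>\<omega> z. \<omega> z = 1) \<in> measurable P (site_percolation p1)"
    and "distr P (site_percolation p1) (\<lambda>\<omega> z. \<omega> z = 1) = site_percolation p1"
proof -
  interpret prob_space P by (rule P)
  have p1_range: "0 \<le> p1" "p1 \<le> 1" using p1 by auto
  let ?b = "measure_pmf (bernoulli_pmf p1)"
  have coord: "(\<lambda>\<omega>. \<omega> x) \<in> borel_measurable P" for x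
    using indep unfolding indep_vars_def by blast
  have isone: "(\<lambda>r::real. r = 1) \<in> measurable borel ?b" by simp
  have indep': "indep_vars (\<lambda>_. ?b) (\<lambda>z \<omega>. \<omega> z = 1) UNIV"
    by (rule indep_vars_compose2[OF indep isone])
  have rv: "(\<lambda>\<omega>. \<omega> z = 1) \<in> measurable P ?b" for z
    using measurable_compose[OF coord isone] .
  have prob_open: "prob {\<omega> \<in> space P. \<omega> z = 1} = p1" for z
    using arg_cong[OF ident[of z], of "\<lambda>M. measure M {1}"]
    by (simp add: measure_distr[OF coord] p1 vimage_def Int_def conj_commute)
  have law: "distr P ?b (\<lambda>\<omega>. \<omega> z = 1) = ?b" for z
  proof -
    interpret D: prob_space "distr P ?b (\<lambda>\<omega>. \<omega> z = 1)" by (rule prob_space_distr[OF rv])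
    have T: "measure (distr P ?b (\<lambda>\<omega>. \<omega> z = 1)) {True} = p1"
      using prob_open[of z] by (simp add: measure_distr[OF rv] vimage_def Int_def conj_commute)
    have "measure (distr P ?b (\<lambda>\<omega>. \<omega> z = 1)) {False} = 1 - p1"
      using D.prob_compl[of "{True}"] T by (simp add: Compl_eq_Diff_UNIV[symmetric] UNIV_bool insert_Diff_if)
    with T have "measure (distr P ?b (\<lambda>\<omega>. \<omega> z = 1)) {v} = measure ?b {v}" for v
      using p1_range by (cases v) (auto simp: measure_pmf_single)
    then show ?thesis
      by (intro measure_eqI_finite[of _ UNIV])
        (auto simp: D.emeasure_eq_measure measure_pmf.emeasure_eq_measure)
  qed
  show "(\<lambda>\<omega> z. \<omega> z = 1) \<in> measurable P (site_percolation p1)"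
    unfolding site_percolation_def using rv by (intro measurable_PiM_single') auto
  show "distr P (site_percolation p1) (\<lambda>\<omega> z. \<omega> z = 1) = site_percolation p1"
    using indep_vars_iff_distr_eq_PiM'[of UNIV "\<lambda>z \<omega>. \<omega> z = 1" "\<lambda>_. ?b"] rv indep'
    by (simp add: law site_percolation_def restrict_def)
qed

theorem theorem3p5:
  fixes P :: "env measure"
    and p c p1 \<beta> :: real
    and B :: "env \<Rightarrow> site \<Rightarrow> site \<Rightarrow> real"
  assumes "prob_space P"
    and "sets P = sets borel"
    and "prob_space.indep_vars P (\<lambda>_. borel) (\<lambda>x \<omega>. \<omega> x) (UNIV :: site set)"
    and "\<And>x. distr P borel (\<lambda>\<omega>. \<omega> x) = distr P borel (\<lambda>\<omega>. \<omega> 0)"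
    and "p > 2" and "integrable P (\<lambda>\<omega>. \<bar>\<omega> 0\<bar> powr p)"
    and "prob_space.variance P (\<lambda>\<omega>. \<omega> 0) > 0"
    and "measure P {\<omega> \<in> space P. \<omega> 0 \<ge> c} = 1"
    and "AE \<omega> in P. \<forall>x. \<omega> x \<le> 1"
    and "p1 = measure P {\<omega> \<in> space P. \<omega> 0 = 1}"
    and "critical_probability < p1" and "p1 < 1"
    and "edge_speed p1 \<beta>"
    and "stationary_L1_cocycle P B"
    and "AE \<omega> in P. \<forall>x y v. cone_sequence \<beta> v \<longrightarrow>
           (\<lambda>n. last_passage \<omega> x (v n) - last_passage \<omega> y (v n)) \<longlonglongrightarrow> B \<omega> x y"
  shows "AE \<omega> in P. \<forall>x y.
           \<bar>psi (translate x \<omega>)\<bar> \<noteq> \<infinity> \<and>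
           B \<omega> x y = real_of_int (fst (y - x) + snd (y - x))
                     + real_of_ereal (psi (translate y \<omega>)) - real_of_ereal (psi (translate x \<omega>))"
proof -
  have p1: "0 \<le> p1" using assms(10) by simp
  \<comment> \<open>Translations centre the property at every site; the reflection gives the other orientation.\<close>
  have transfer: "AE \<omega> in P. \<forall>x. Q (\<lambda>z. \<omega> (x + z) = 1) \<and> Q (\<lambda>z. \<omega> (x + prod.swap z) = 1)"
    if Q: "AE \<sigma> in site_percolation p1. Q \<sigma>" for Q
  proof -
    have "AE \<omega> in P. Q (\<lambda>z. \<omega> (f z) = 1)" if "inj f" for f
    proof -
      have "AE \<sigma> in distr (site_percolation p1) (site_percolation p1) (\<lambda>\<sigma> z. \<sigma> (f z)). Q \<sigma>"
        unfolding site_percolation_reindex[OF that] by (rule Q)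
      from AE_distrD[OF measurable_site_percolation_reindex this]
      have "AE \<sigma> in distr P (site_percolation p1) (\<lambda>\<omega> z. \<omega> z = 1). Q (\<lambda>z. \<sigma> (f z))"
        unfolding iid_open_sites_distr(2)[OF assms(1,3,4,10)] .
      from AE_distrD[OF iid_open_sites_distr(1)[OF assms(1,3,4,10)] this] show ?thesis .
    qed
    moreover have "inj (\<lambda>z. x + z)" "inj (\<lambda>z. x + prod.swap z)" for x :: site
      by (auto simp: inj_def)
    ultimately show ?thesis unfolding AE_all_countable by auto
  qed
  have "p1 \<le> 1" using assms(12) by simp
  note perc = AE_percolates_on_antidiagonal[OF percolation_pos_above_critical[OF assms(11) p1 this]]
  from transfer[OF AE_site_percolation_closed_on_axis[OF p1 assms(12)]]
    transfer[OF perc] transfer[OF assms(13)[unfolded edge_speed_def]] assms(9,15)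
  show ?thesis
  proof eventually_elim
    case (elim \<omega>)
    note closed = elim(1) and perc = elim(2) and speed = elim(3)
    interpret typical_environment \<omega> \<beta> "B \<omega>"
    proof
      fix x show "\<omega> x \<le> 1" using elim(4) by blast
    next
      fix v x y assume "cone_sequence \<beta> v"
      then show "(\<lambda>n. last_passage \<omega> x (v n) - last_passage \<omega> y (v n)) \<longlonglongrightarrow> B \<omega> x y"
        using elim(5) by blast
    next
      fix \<gamma> x assume "open_ray \<omega> \<gamma>"
      then show "\<exists>n. x \<le> \<gamma> n"
        using closed by (intro open_ray_unbounded) auto
    next
      fix \<gamma> N assume ray: "open_ray \<omega> \<gamma>" "0 \<le> \<gamma> N"
      then have "percolates (\<lambda>z. \<omega> z = 1) (\<gamma> 0)" by (auto simp: percolates_iff_open_ray)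
      then have 1: "percolates (\<lambda>z. \<omega> (\<gamma> 0 + z) = 1) 0"
        using percolates_translate[of "\<lambda>z. \<omega> z = 1" "\<gamma> 0"] by simp
      moreover have swap_zero: "prod.swap (0 :: site) = 0" by (simp add: zero_prod_def)
      ultimately have "percolates (\<lambda>z. \<omega> (\<gamma> 0 + prod.swap z) = 1) 0"
        using percolates_swap[of "\<lambda>z. \<omega> (\<gamma> 0 + prod.swap z) = 1" 0 0]
        by (simp add: swap_zero)
      with 1 show "cone_sequence \<beta> (\<lambda>n. \<gamma> (n + N))"
        using speed by (intro open_ray_cone_sequence[OF ray]) blast+
    next
      fix x
      obtain k where k: "k \<ge> 1" "percolates (\<lambda>z. \<omega> (x + z) = 1) (- int k, int k)"
        using perc by blast
      have "percolates (\<lambda>z. \<omega> z = 1) (x + (- int k, int k))"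
        using k(2) percolates_translate[of "\<lambda>z. \<omega> (x + z) = 1" "(- int k, int k)"]
          percolates_translate[of "\<lambda>z. \<omega> z = 1" "x + (- int k, int k)"]
        by (simp add: add.assoc)
      then show "\<exists>u. percolates (\<lambda>x. \<omega> x = 1) u \<and> fst u < fst x \<and> level x \<le> level u"
        using k(1) by (intro exI[of _ "x + (- int k, int k)"]) (auto simp: level_def)
    next
      fix x
      obtain k where k: "k \<ge> 1" "percolates (\<lambda>z. \<omega> (x + prod.swap z) = 1) (- int k, int k)"
        using perc by blast
      from percolates_swap[of "\<lambda>z. \<omega> z = 1", OF k(2)]
      show "\<exists>v. percolates (\<lambda>x. \<omega> x = 1) v \<and> snd v < snd x \<and> level x \<le> level v"
        using k(1) by (intro exI[of _ "x + (int k, - int k)"]) (auto simp: level_def)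
    qed
    show ?case using busemann_eq_psi by blast
  qed
qed

end
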